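(* Let $I$ be a set, let $\mathcal{G}=I\times I$ be the associated pair groupoid, and let $B$ be a unital ring. Then the ring extension $B[\mathcal{G}]/B\mathcal{G}_0$ is separable.
   Context: The groupoid structure on $\mathcal{G}=I\times I$: $(i,j)^{-1}=(j,i)$, and $(i,j)(k,l)$ is defined precisely when $j=k$, in which case it equals $(i,l)$. Its set of identity elements is $\mathcal{G}_0=\{(i,i)\mid i\in I\}$. The groupoid ring $B[\mathcal{G}]$ consists of formal sums $\sum_{\sigma\in\mathcal{G}}b_\sigma u_\sigma$ with $b_\sigma\in B$ almost all zero, with product the additive extension of $bu_\sigma\cdot b'u_\tau=bb'u_{\sigma\tau}$ if $\sigma\tau$ is defined and $0$ otherwise; it is the (not necessarily unital) ring of finite matrices over $B$ with index set $I$. $B\mathcal{G}_0=\bigoplus_{e\in\mathcal{G}_0}Bu_e$. A ring extension $S/T$ (i.e. $T$ is a subring of $S$; rings are associative but not necessarily unital) is separable if the multiplication map $\mu:S\otimes_TS\to S$ has an $S$-bimodule section. *)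

theory Defs
  imports "HOL-Algebra.Algebra"
begin

section \<open>Rings without unit and separable extensions\<close>

text \<open>
  The \<open>ring\<close> record is reused; its \<open>one\<close> field plays no role and is unconstrained.
\<close>

locale nonunital_ring = abelian_group R for R (structure) +
  assumes nu_m_closed: "\<lbrakk>x \<in> carrier R; y \<in> carrier R\<rbrakk> \<Longrightarrow> x \<otimes> y \<in> carrier R"
    and nu_m_assoc: "\<lbrakk>x \<in> carrier R; y \<in> carrier R; z \<in> carrier R\<rbrakk>
          \<Longrightarrow> (x \<otimes> y) \<otimes> z = x \<otimes> (y \<otimes> z)"
    and nu_l_distr: "\<lbrakk>x \<in> carrier R; y \<in> carrier R; z \<in> carrier R\<rbrakk>
          \<Longrightarrow> (x \<oplus> y) \<otimes> z = x \<otimes> z \<oplus> y \<otimes> z"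
    and nu_r_distr: "\<lbrakk>x \<in> carrier R; y \<in> carrier R; z \<in> carrier R\<rbrakk>
          \<Longrightarrow> z \<otimes> (x \<oplus> y) = z \<otimes> x \<oplus> z \<otimes> y"

text \<open>A subring \<open>T\<close> is given by its carrier; no unit is required of it either.\<close>

locale nonunital_ring_extension = nonunital_ring S + additive_subgroup T S
  for S (structure) and T +
  assumes sub_m_closed: "\<lbrakk>x \<in> T; y \<in> T\<rbrakk> \<Longrightarrow> x \<otimes> y \<in> T"

text \<open>
  \<open>S \<otimes>\<^sub>T S\<close>: the free abelian group on pairs modulo the subgroup generated by the relations of
  biadditivity and \<open>T\<close>-balancedness. Its elements are cosets of that subgroup.
\<close>

definition tensor_free :: "('a, 'm) ring_scheme \<Rightarrow> ('a \<times> 'a \<Rightarrow>\<^sub>0 int) monoid" where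
  "tensor_free S = free_Abelian_group (carrier S \<times> carrier S)"

definition tensor_relations :: "('a, 'm) ring_scheme \<Rightarrow> 'a set \<Rightarrow> ('a \<times> 'a \<Rightarrow>\<^sub>0 int) set" where
  "tensor_relations S T =
     {frag_of (x \<oplus>\<^bsub>S\<^esub> x', y) - frag_of (x, y) - frag_of (x', y) | x x' y.
        x \<in> carrier S \<and> x' \<in> carrier S \<and> y \<in> carrier S} \<union>
     {frag_of (x, y \<oplus>\<^bsub>S\<^esub> y') - frag_of (x, y) - frag_of (x, y') | x y y'.
        x \<in> carrier S \<and> y \<in> carrier S \<and> y' \<in> carrier S} \<union>
     {frag_of (x \<otimes>\<^bsub>S\<^esub> t, y) - frag_of (x, t \<otimes>\<^bsub>S\<^esub> y) | x t y.
        x \<in> carrier S \<and> t \<in> T \<and> y \<in> carrier S}"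

definition tensor_kernel :: "('a, 'm) ring_scheme \<Rightarrow> 'a set \<Rightarrow> ('a \<times> 'a \<Rightarrow>\<^sub>0 int) set" where
  "tensor_kernel S T = generate (tensor_free S) (tensor_relations S T)"

definition tensor_square ::
    "('a, 'm) ring_scheme \<Rightarrow> 'a set \<Rightarrow> ('a \<times> 'a \<Rightarrow>\<^sub>0 int) set monoid" where
  "tensor_square S T = tensor_free S Mod tensor_kernel S T"

definition pure_tensor ::
    "('a, 'm) ring_scheme \<Rightarrow> 'a set \<Rightarrow> 'a \<Rightarrow> 'a \<Rightarrow> ('a \<times> 'a \<Rightarrow>\<^sub>0 int) set" where
  "pure_tensor S T x y = tensor_kernel S T #>\<^bsub>tensor_free S\<^esub> frag_of (x, y)"

text \<open>
  The multiplication map and the two actions are the maps induced on cosets by homomorphisms on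
  the free abelian group; their values on pure tensors are proved below.
\<close>

definition free_mult :: "('a, 'm) ring_scheme \<Rightarrow> ('a \<times> 'a \<Rightarrow>\<^sub>0 int) \<Rightarrow> 'a" where
  "free_mult S f =
     (\<Oplus>\<^bsub>S\<^esub>p \<in> Poly_Mapping.keys f. [Poly_Mapping.lookup f p] \<cdot>\<^bsub>S\<^esub> (fst p \<otimes>\<^bsub>S\<^esub> snd p))"

definition tensor_mult :: "('a, 'm) ring_scheme \<Rightarrow> ('a \<times> 'a \<Rightarrow>\<^sub>0 int) set \<Rightarrow> 'a" where
  "tensor_mult S c = the_elem (free_mult S ` c)"

definition tensor_lact :: "('a, 'm) ring_scheme \<Rightarrow> 'a set \<Rightarrow> 'a
    \<Rightarrow> ('a \<times> 'a \<Rightarrow>\<^sub>0 int) set \<Rightarrow> ('a \<times> 'a \<Rightarrow>\<^sub>0 int) set" where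
  "tensor_lact S T s c = the_elem ((\<lambda>f. tensor_kernel S T #>\<^bsub>tensor_free S\<^esub>
     frag_extend (\<lambda>(x, y). frag_of (s \<otimes>\<^bsub>S\<^esub> x, y)) f) ` c)"

definition tensor_ract :: "('a, 'm) ring_scheme \<Rightarrow> 'a set
    \<Rightarrow> ('a \<times> 'a \<Rightarrow>\<^sub>0 int) set \<Rightarrow> 'a \<Rightarrow> ('a \<times> 'a \<Rightarrow>\<^sub>0 int) set" where
  "tensor_ract S T c s = the_elem ((\<lambda>f. tensor_kernel S T #>\<^bsub>tensor_free S\<^esub>
     frag_extend (\<lambda>(x, y). frag_of (x, y \<otimes>\<^bsub>S\<^esub> s)) f) ` c)"

definition bimodule_section :: "('a, 'm) ring_scheme \<Rightarrow> 'a set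
    \<Rightarrow> ('a \<Rightarrow> ('a \<times> 'a \<Rightarrow>\<^sub>0 int) set) \<Rightarrow> bool" where
  "bimodule_section S T \<delta> \<longleftrightarrow>
     \<delta> \<in> hom (add_monoid S) (tensor_square S T) \<and>
     (\<forall>s\<in>carrier S. \<forall>x\<in>carrier S. \<delta> (s \<otimes>\<^bsub>S\<^esub> x) = tensor_lact S T s (\<delta> x)) \<and>
     (\<forall>s\<in>carrier S. \<forall>x\<in>carrier S. \<delta> (x \<otimes>\<^bsub>S\<^esub> s) = tensor_ract S T (\<delta> x) s) \<and>
     (\<forall>x\<in>carrier S. tensor_mult S (\<delta> x) = x)"

definition separable_extension :: "('a, 'm) ring_scheme \<Rightarrow> 'a set \<Rightarrow> bool" where
  "separable_extension S T \<longleftrightarrow>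
     nonunital_ring_extension S T \<and> (\<exists>\<delta>. bimodule_section S T \<delta>)"

subsection \<open>The induced maps are well defined\<close>

lemma carrier_tensor_free:
  "f \<in> carrier (tensor_free S) \<longleftrightarrow> Poly_Mapping.keys f \<subseteq> carrier S \<times> carrier S"
  by (simp add: tensor_free_def free_Abelian_group_def)

lemma mult_tensor_free: "f \<otimes>\<^bsub>tensor_free S\<^esub> g = f + g"
  by (simp add: tensor_free_def free_Abelian_group_def)

lemma one_tensor_free: "\<one>\<^bsub>tensor_free S\<^esub> = 0"
  by (simp add: tensor_free_def free_Abelian_group_def)

lemma comm_group_tensor_free: "comm_group (tensor_free S)"
  by (simp add: tensor_free_def abelian_free_Abelian_group)

lemma frag_of_in_tensor_free:
  "\<lbrakk>x \<in> carrier S; y \<in> carrier S\<rbrakk> \<Longrightarrow> frag_of (x, y) \<in> carrier (tensor_free S)"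
  by (simp add: carrier_tensor_free)

lemma diff_in_tensor_free:
  "\<lbrakk>f \<in> carrier (tensor_free S); g \<in> carrier (tensor_free S)\<rbrakk>
    \<Longrightarrow> f - g \<in> carrier (tensor_free S)"
  using keys_diff[of f g] by (auto simp: carrier_tensor_free)

lemma (in nonunital_ring_extension) tensor_relations_subset:
  "tensor_relations S T \<subseteq> carrier (tensor_free S)"
  using nu_m_closed a_subset unfolding tensor_relations_def
  by (auto intro!: diff_in_tensor_free frag_of_in_tensor_free)

lemma (in nonunital_ring_extension) subgroup_tensor_kernel:
  "subgroup (tensor_kernel S T) (tensor_free S)"
  unfolding tensor_kernel_def
  by (intro group.generate_is_subgroup comm_group.axioms comm_group_tensor_free
      tensor_relations_subset)

lemma (in nonunital_ring_extension) group_tensor_square: "comm_group (tensor_square S T)"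
  unfolding tensor_square_def
  by (intro comm_group.abelian_FactGroup comm_group_tensor_free subgroup_tensor_kernel)

lemma (in nonunital_ring_extension) tensor_induced:
  assumes H: "group H" and h: "h \<in> hom (tensor_free S) H"
    and rel: "\<And>r. r \<in> tensor_relations S T \<Longrightarrow> h r = \<one>\<^bsub>H\<^esub>"
    and f: "f \<in> carrier (tensor_free S)"
  shows "the_elem (h ` (tensor_kernel S T #>\<^bsub>tensor_free S\<^esub> f)) = h f"
proof -
  interpret F: comm_group "tensor_free S" by (rule comm_group_tensor_free)
  interpret h: group_hom "tensor_free S" H h
    by (simp add: group_hom_def group_hom_axioms_def F.is_group H h)
  have "tensor_kernel S T \<subseteq> kernel (tensor_free S) H h"
    unfolding tensor_kernel_def
    by (rule F.generate_subgroup_incl[OF _ h.subgroup_kernel])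
      (use rel tensor_relations_subset in \<open>auto simp: kernel_def\<close>)
  then have "h (k \<otimes>\<^bsub>tensor_free S\<^esub> f) = h f" if "k \<in> tensor_kernel S T" for k
    using that f by (auto simp: kernel_def)
  moreover have "tensor_kernel S T \<noteq> {}"
    using subgroup.one_closed[OF subgroup_tensor_kernel] by blast
  ultimately have "h ` (tensor_kernel S T #>\<^bsub>tensor_free S\<^esub> f) = {h f}"
    unfolding r_coset_def by (auto simp: image_UN)
  then show ?thesis by simp
qed

lemma (in nonunital_ring) free_mult_eq:
  assumes "finite A" "Poly_Mapping.keys f \<subseteq> A" "A \<subseteq> carrier R \<times> carrier R"
  shows "free_mult R f = (\<Oplus>p\<in>A. [Poly_Mapping.lookup f p] \<cdot> (fst p \<otimes> snd p))"
  unfolding free_mult_def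
proof (rule add.finprod_mono_neutral_cong_left)
  show "\<And>p. p \<in> A - Poly_Mapping.keys f \<Longrightarrow> [Poly_Mapping.lookup f p] \<cdot> (fst p \<otimes> snd p) = \<zero>"
    by (simp add: in_keys_iff add_pow_def)
qed (use assms in \<open>auto intro!: add.int_pow_closed nu_m_closed\<close>)

lemma (in nonunital_ring) free_mult_hom: "free_mult R \<in> hom (tensor_free R) (add_monoid R)"
proof (rule homI)
  fix f assume f: "f \<in> carrier (tensor_free R)"
  then show "free_mult R f \<in> carrier (add_monoid R)"
    by (auto simp: free_mult_def carrier_tensor_free intro!: finsum_closed add.int_pow_closed nu_m_closed)
  fix g assume g: "g \<in> carrier (tensor_free R)"
  let ?A = "Poly_Mapping.keys f \<union> Poly_Mapping.keys g"
  have A: "finite ?A" "?A \<subseteq> carrier R \<times> carrier R"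
    using f g by (auto simp: carrier_tensor_free)
  have m: "fst p \<otimes> snd p \<in> carrier R" if "p \<in> ?A" for p
    using that A nu_m_closed by auto
  have "free_mult R (f + g) = (\<Oplus>p\<in>?A. [Poly_Mapping.lookup (f + g) p] \<cdot> (fst p \<otimes> snd p))"
    by (rule free_mult_eq) (use A keys_add[of f g] in auto)
  also have "\<dots> = (\<Oplus>p\<in>?A. [Poly_Mapping.lookup f p] \<cdot> (fst p \<otimes> snd p) \<oplus>
      [Poly_Mapping.lookup g p] \<cdot> (fst p \<otimes> snd p))"
    by (rule finsum_cong') (use m in \<open>auto simp: lookup_add add.int_pow_mult intro!: add.int_pow_closed\<close>)
  also have "\<dots> = (\<Oplus>p\<in>?A. [Poly_Mapping.lookup f p] \<cdot> (fst p \<otimes> snd p)) \<oplus>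
      (\<Oplus>p\<in>?A. [Poly_Mapping.lookup g p] \<cdot> (fst p \<otimes> snd p))"
    by (rule finsum_addf) (use m in \<open>auto intro!: add.int_pow_closed\<close>)
  also have "\<dots> = free_mult R f \<oplus> free_mult R g"
    using free_mult_eq[of ?A f] free_mult_eq[of ?A g] A by simp
  finally show "free_mult R (f \<otimes>\<^bsub>tensor_free R\<^esub> g)
      = free_mult R f \<otimes>\<^bsub>add_monoid R\<^esub> free_mult R g"
    by (simp add: mult_tensor_free)
qed

lemma (in nonunital_ring) free_mult_frag_of:
  "\<lbrakk>x \<in> carrier R; y \<in> carrier R\<rbrakk> \<Longrightarrow> free_mult R (frag_of (x, y)) = x \<otimes> y"
  by (simp add: free_mult_def nu_m_closed)

lemma (in nonunital_ring) free_mult_diff: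
  assumes "f \<in> carrier (tensor_free R)" "g \<in> carrier (tensor_free R)"
  shows "free_mult R (f - g) = free_mult R f \<ominus> free_mult R g"
proof -
  have c: "free_mult R h \<in> carrier R" if "h \<in> carrier (tensor_free R)" for h
    using hom_in_carrier[OF free_mult_hom that] by simp
  have "free_mult R f = free_mult R (f - g) \<oplus> free_mult R g"
    using hom_mult[OF free_mult_hom diff_in_tensor_free[OF assms] assms(2)]
    by (simp add: mult_tensor_free)
  then show ?thesis
    using c assms diff_in_tensor_free[OF assms] by (simp add: minus_eq a_assoc r_neg)
qed

lemma (in nonunital_ring_extension) tensor_mult_coset:
  assumes "f \<in> carrier (tensor_free S)"
  shows "tensor_mult S (tensor_kernel S T #>\<^bsub>tensor_free S\<^esub> f) = free_mult S f"
  unfolding tensor_mult_def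
proof (rule tensor_induced[OF a_group free_mult_hom _ assms])
  fix r assume "r \<in> tensor_relations S T"
  then show "free_mult S r = \<one>\<^bsub>add_monoid S\<^esub>"
    using a_subset unfolding tensor_relations_def
    by (auto simp: free_mult_diff free_mult_frag_of diff_in_tensor_free frag_of_in_tensor_free
        nu_m_closed nu_l_distr nu_r_distr nu_m_assoc subset_iff minus_eq a_assoc
        r_neg r_neg1 r_neg2 a_lcomm[of _ "\<ominus> _"])
qed

lemma (in nonunital_ring_extension) tensor_mult_pure:
  "\<lbrakk>x \<in> carrier S; y \<in> carrier S\<rbrakk> \<Longrightarrow> tensor_mult S (pure_tensor S T x y) = x \<otimes> y"
  by (simp add: pure_tensor_def tensor_mult_coset frag_of_in_tensor_free free_mult_frag_of)

lemma (in nonunital_ring_extension) coset_extend_hom: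
  assumes "\<And>p. p \<in> carrier S \<times> carrier S \<Longrightarrow> b p \<in> carrier (tensor_free S)"
  shows "(\<lambda>f. tensor_kernel S T #>\<^bsub>tensor_free S\<^esub> frag_extend b f)
           \<in> hom (tensor_free S) (tensor_square S T)"
proof -
  have ex: "frag_extend b \<in> hom (tensor_free S) (tensor_free S)"
  proof (rule homI)
    fix f assume "f \<in> carrier (tensor_free S)"
    with assms show "frag_extend b f \<in> carrier (tensor_free S)"
      using keys_frag_extend[of b f] unfolding carrier_tensor_free by blast
  qed (simp add: mult_tensor_free frag_extend_add)
  have "tensor_kernel S T \<lhd> tensor_free S"
    by (simp add: comm_group.normal_iff_subgroup comm_group_tensor_free subgroup_tensor_kernel)
  from normal.r_coset_hom_Mod[OF this] ex show ?thesis
    unfolding tensor_square_def by (drule_tac hom_compose) (auto simp: comp_def)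
qed

lemma (in nonunital_ring_extension) coset_eqI:
  assumes "f - g \<in> tensor_relations S T" "f \<in> carrier (tensor_free S)" "g \<in> carrier (tensor_free S)"
  shows "tensor_kernel S T #>\<^bsub>tensor_free S\<^esub> f = tensor_kernel S T #>\<^bsub>tensor_free S\<^esub> g"
proof -
  interpret F: comm_group "tensor_free S" by (rule comm_group_tensor_free)
  have "f - g \<in> tensor_kernel S T"
    using assms(1) by (simp add: tensor_kernel_def generate.incl)
  then have "f \<in> tensor_kernel S T #>\<^bsub>tensor_free S\<^esub> g"
    unfolding r_coset_def by (force simp: mult_tensor_free)
  then show ?thesis
    using F.repr_independence[OF _ assms(3) subgroup_tensor_kernel] by simp
qed

lemma (in nonunital_ring_extension) coset_relation:
  assumes "f \<in> tensor_relations S T"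
  shows "tensor_kernel S T #>\<^bsub>tensor_free S\<^esub> f = \<one>\<^bsub>tensor_square S T\<^esub>"
proof -
  interpret F: comm_group "tensor_free S" by (rule comm_group_tensor_free)
  have "f \<in> tensor_kernel S T"
    using assms by (simp add: tensor_kernel_def generate.incl)
  then show ?thesis
    by (simp add: tensor_square_def F.coset_join2 subgroup_tensor_kernel
        subgroup.mem_carrier[OF subgroup_tensor_kernel])
qed

lemma (in nonunital_ring_extension) tensor_lact_coset:
  assumes s: "s \<in> carrier S" and f: "f \<in> carrier (tensor_free S)"
  shows "tensor_lact S T s (tensor_kernel S T #>\<^bsub>tensor_free S\<^esub> f) =
    tensor_kernel S T #>\<^bsub>tensor_free S\<^esub> frag_extend (\<lambda>(x, y). frag_of (s \<otimes> x, y)) f"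
  unfolding tensor_lact_def
proof (rule tensor_induced[OF comm_group.axioms(2)[OF group_tensor_square] coset_extend_hom _ f])
  fix r assume "r \<in> tensor_relations S T"
  let ?b = "(\<lambda>(x, y). frag_of (s \<otimes> x, y))"
  from \<open>r \<in> tensor_relations S T\<close> consider
    (1) x x' y where "r = frag_of (x \<oplus> x', y) - frag_of (x, y) - frag_of (x', y)"
      "x \<in> carrier S" "x' \<in> carrier S" "y \<in> carrier S"
  | (2) x y y' where "r = frag_of (x, y \<oplus> y') - frag_of (x, y) - frag_of (x, y')"
      "x \<in> carrier S" "y \<in> carrier S" "y' \<in> carrier S"
  | (3) x t y where "r = frag_of (x \<otimes> t, y) - frag_of (x, t \<otimes> y)"
      "x \<in> carrier S" "t \<in> T" "y \<in> carrier S"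
    unfolding tensor_relations_def by blast
  then have "frag_extend ?b r \<in> tensor_relations S T"
  proof cases
    case 1
    have "frag_extend ?b r = frag_of (s \<otimes> x \<oplus> s \<otimes> x', y) - frag_of (s \<otimes> x, y) - frag_of (s \<otimes> x', y)"
      using 1 s by (simp add: frag_extend_diff nu_r_distr)
    moreover have "\<dots> \<in> tensor_relations S T"
      unfolding tensor_relations_def using 1 s nu_m_closed by blast
    ultimately show ?thesis by simp
  next
    case 2
    have "frag_extend ?b r = frag_of (s \<otimes> x, y \<oplus> y') - frag_of (s \<otimes> x, y) - frag_of (s \<otimes> x, y')"
      using 2 s by (simp add: frag_extend_diff)
    moreover have "\<dots> \<in> tensor_relations S T"
      unfolding tensor_relations_def using 2 s nu_m_closed by blast
    ultimately show ?thesis by simp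
  next
    case 3
    then have "t \<in> carrier S" using a_subset by blast
    then have "frag_extend ?b r = frag_of ((s \<otimes> x) \<otimes> t, y) - frag_of (s \<otimes> x, t \<otimes> y)"
      using 3 s by (simp add: frag_extend_diff nu_m_assoc)
    moreover have "\<dots> \<in> tensor_relations S T"
      unfolding tensor_relations_def using 3 s nu_m_closed by blast
    ultimately show ?thesis by simp
  qed
  then show "tensor_kernel S T #>\<^bsub>tensor_free S\<^esub> frag_extend (\<lambda>(x, y). frag_of (s \<otimes> x, y)) r
      = \<one>\<^bsub>tensor_square S T\<^esub>"
    by (rule coset_relation)
qed (use s nu_m_closed in \<open>auto intro!: frag_of_in_tensor_free\<close>)

lemma (in nonunital_ring_extension) tensor_ract_coset:
  assumes s: "s \<in> carrier S" and f: "f \<in> carrier (tensor_free S)"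
  shows "tensor_ract S T (tensor_kernel S T #>\<^bsub>tensor_free S\<^esub> f) s =
    tensor_kernel S T #>\<^bsub>tensor_free S\<^esub> frag_extend (\<lambda>(x, y). frag_of (x, y \<otimes> s)) f"
  unfolding tensor_ract_def
proof (rule tensor_induced[OF comm_group.axioms(2)[OF group_tensor_square] coset_extend_hom _ f])
  fix r assume "r \<in> tensor_relations S T"
  let ?b = "(\<lambda>(x, y). frag_of (x, y \<otimes> s))"
  from \<open>r \<in> tensor_relations S T\<close> consider
    (1) x x' y where "r = frag_of (x \<oplus> x', y) - frag_of (x, y) - frag_of (x', y)"
      "x \<in> carrier S" "x' \<in> carrier S" "y \<in> carrier S"
  | (2) x y y' where "r = frag_of (x, y \<oplus> y') - frag_of (x, y) - frag_of (x, y')"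
      "x \<in> carrier S" "y \<in> carrier S" "y' \<in> carrier S"
  | (3) x t y where "r = frag_of (x \<otimes> t, y) - frag_of (x, t \<otimes> y)"
      "x \<in> carrier S" "t \<in> T" "y \<in> carrier S"
    unfolding tensor_relations_def by blast
  then have "frag_extend ?b r \<in> tensor_relations S T"
  proof cases
    case 1
    have "frag_extend ?b r = frag_of (x \<oplus> x', y \<otimes> s) - frag_of (x, y \<otimes> s) - frag_of (x', y \<otimes> s)"
      using 1 s by (simp add: frag_extend_diff)
    moreover have "\<dots> \<in> tensor_relations S T"
      unfolding tensor_relations_def using 1 s nu_m_closed by blast
    ultimately show ?thesis by simp
  next
    case 2
    have "frag_extend ?b r = frag_of (x, y \<otimes> s \<oplus> y' \<otimes> s) - frag_of (x, y \<otimes> s) - frag_of (x, y' \<otimes> s)"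
      using 2 s by (simp add: frag_extend_diff nu_l_distr)
    moreover have "\<dots> \<in> tensor_relations S T"
      unfolding tensor_relations_def using 2 s nu_m_closed by blast
    ultimately show ?thesis by simp
  next
    case 3
    then have "t \<in> carrier S" using a_subset by blast
    then have "frag_extend ?b r = frag_of (x \<otimes> t, y \<otimes> s) - frag_of (x, t \<otimes> (y \<otimes> s))"
      using 3 s by (simp add: frag_extend_diff nu_m_assoc)
    moreover have "\<dots> \<in> tensor_relations S T"
      unfolding tensor_relations_def using 3 s nu_m_closed by blast
    ultimately show ?thesis by simp
  qed
  then show "tensor_kernel S T #>\<^bsub>tensor_free S\<^esub> frag_extend (\<lambda>(x, y). frag_of (x, y \<otimes> s)) r
      = \<one>\<^bsub>tensor_square S T\<^esub>"
    by (rule coset_relation)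
qed (use s nu_m_closed in \<open>auto intro!: frag_of_in_tensor_free\<close>)

lemma (in nonunital_ring_extension) tensor_act_pure:
  assumes "s \<in> carrier S" "x \<in> carrier S" "y \<in> carrier S"
  shows "tensor_lact S T s (pure_tensor S T x y) = pure_tensor S T (s \<otimes> x) y"
    and "tensor_ract S T (pure_tensor S T x y) s = pure_tensor S T x (y \<otimes> s)"
  using assms
  by (simp_all add: pure_tensor_def tensor_lact_coset tensor_ract_coset frag_of_in_tensor_free)


section \<open>Groupoid rings and pair groupoids\<close>

text \<open>The composite is \<open>None\<close> exactly when it is not defined.\<close>

record 'g groupoid =
  arrows :: "'g set"
  gcomp :: "'g \<Rightarrow> 'g \<Rightarrow> 'g option"
  ginv :: "'g \<Rightarrow> 'g"

definition identities :: "('g, 'm) groupoid_scheme \<Rightarrow> 'g set" where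
  "identities G = {e. \<exists>\<sigma>\<in>arrows G. gcomp G (ginv G \<sigma>) \<sigma> = Some e}"

definition pair_groupoid :: "'i set \<Rightarrow> ('i \<times> 'i) groupoid" where
  "pair_groupoid I =
     \<lparr>arrows = I \<times> I,
      gcomp = (\<lambda>(i, j) (k, l). if j = k then Some (i, l) else None),
      ginv = (\<lambda>(i, j). (j, i))\<rparr>"

lemma identities_pair_groupoid: "identities (pair_groupoid I) = {(i, i) | i. i \<in> I}"
  by (auto simp: identities_def pair_groupoid_def)

text \<open>
  A formal sum is its finitely supported coefficient function. The coefficient of a product at
  \<open>\<rho>\<close> is a sum over a subset of the product of the two supports, hence finite. The ring has no
  unit in general, so the \<open>one\<close> field is left \<open>undefined\<close>.
\<close>

definition support ::
    "('b, 'm) ring_scheme \<Rightarrow> ('g, 'n) groupoid_scheme \<Rightarrow> ('g \<Rightarrow> 'b) \<Rightarrow> 'g set" where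
  "support B G x = {\<sigma> \<in> arrows G. x \<sigma> \<noteq> \<zero>\<^bsub>B\<^esub>}"

definition groupoid_ring ::
    "('b, 'm) ring_scheme \<Rightarrow> ('g, 'n) groupoid_scheme \<Rightarrow> ('g \<Rightarrow> 'b) ring" where
  "groupoid_ring B G =
     \<lparr>carrier = {x \<in> arrows G \<rightarrow>\<^sub>E carrier B. finite (support B G x)},
      monoid.mult = (\<lambda>x y. \<lambda>\<rho>\<in>arrows G.
        \<Oplus>\<^bsub>B\<^esub>p \<in> {p \<in> support B G x \<times> support B G y. gcomp G (fst p) (snd p) = Some \<rho>}.
          x (fst p) \<otimes>\<^bsub>B\<^esub> y (snd p)),
      monoid.one = undefined,
      ring.zero = (\<lambda>\<sigma>\<in>arrows G. \<zero>\<^bsub>B\<^esub>),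
      ring.add = (\<lambda>x y. \<lambda>\<sigma>\<in>arrows G. x \<sigma> \<oplus>\<^bsub>B\<^esub> y \<sigma>)\<rparr>"

definition identity_subring ::
    "('b, 'm) ring_scheme \<Rightarrow> ('g, 'n) groupoid_scheme \<Rightarrow> ('g \<Rightarrow> 'b) set" where
  "identity_subring B G =
     {x \<in> carrier (groupoid_ring B G). support B G x \<subseteq> identities G}"

end

theory Submission
  imports Defs
begin

text \<open>
  Fix \<open>k \<in> I\<close> and let \<open>e\<^sub>i\<^sub>j\<close> be the matrix units. A section of the multiplication map is
  \<open>x \<mapsto> \<Sum>\<^sub>j x e\<^sub>j\<^sub>k \<otimes> e\<^sub>k\<^sub>j\<close>, a finite sum because \<open>x\<close> has only finitely many nonzero columns. Left linearity
  is clear and \<open>\<Sum>\<^sub>j x e\<^sub>j\<^sub>j = x\<close>. For right linearity expand \<open>e\<^sub>k\<^sub>j s = \<Sum>\<^sub>l (e\<^sub>k\<^sub>j s e\<^sub>l\<^sub>k) e\<^sub>k\<^sub>l\<close> and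
  move the coefficients \<open>e\<^sub>k\<^sub>j s e\<^sub>l\<^sub>k = s\<^sub>j\<^sub>l e\<^sub>k\<^sub>k\<close>, which are diagonal, across the tensor sign.
\<close>

section \<open>Finite products in commutative groups\<close>

text \<open>Ring sums are products in \<open>add_monoid\<close>, and the tensor square is written
  multiplicatively, so this one fact moves finite sums through every additive map below. For
  infinite \<open>A\<close> both products are the unit by convention.\<close>

lemma hom_finprod:
  assumes "comm_group G" "comm_group H" "h \<in> hom G H" "f \<in> A \<rightarrow> carrier G"
  shows "h (finprod G f A) = finprod H (\<lambda>a. h (f a)) A"
proof -
  interpret G: comm_group G by fact
  interpret H: comm_group H by fact
  have one: "h \<one>\<^bsub>G\<^esub> = \<one>\<^bsub>H\<^esub>"
    using hom_one[OF assms(3)] by (simp add: G.is_group H.is_group)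
  have cl: "h x \<in> carrier H" if "x \<in> carrier G" for x
    using that assms(3) by (rule hom_in_carrier[rotated])
  show ?thesis
    using assms(4)
  proof (induction A rule: infinite_finite_induct)
    case (insert a A)
    then have f: "f \<in> A \<rightarrow> carrier G" "f a \<in> carrier G" by auto
    then show ?case
      using insert cl by (simp add: hom_mult[OF assms(3)] Pi_iff)
  qed (simp_all add: one)
qed

text \<open>Serves for sums in the coefficient ring (associativity of matrix products) and for sums
  in the tensor square (right linearity of the section).\<close>

lemma (in comm_monoid) finprod_swap:
  assumes "finite A" "finite B" "\<And>a b. a \<in> A \<Longrightarrow> b \<in> B \<Longrightarrow> f a b \<in> carrier G"
  shows "(\<Otimes>a\<in>A. \<Otimes>b\<in>B. f a b) = (\<Otimes>b\<in>B. \<Otimes>a\<in>A. f a b)"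
  using assms(1,3)
proof (induction A rule: finite_induct)
  case (insert a A)
  have "(\<Otimes>b\<in>B. \<Otimes>a\<in>insert a A. f a b) = (\<Otimes>b\<in>B. f a b \<otimes> (\<Otimes>a\<in>A. f a b))"
    by (rule finprod_cong') (use insert in \<open>auto intro!: m_closed finprod_closed\<close>)
  also have "\<dots> = (\<Otimes>b\<in>B. f a b) \<otimes> (\<Otimes>b\<in>B. \<Otimes>a\<in>A. f a b)"
    by (rule finprod_multf) (use insert in \<open>auto intro!: finprod_closed\<close>)
  finally show ?case
    using insert by (simp add: Pi_iff finprod_closed)
qed simp

section \<open>Arithmetic in rings without unit\<close>

context nonunital_ring
begin

lemma nu_l_null: "x \<in> carrier R \<Longrightarrow> \<zero> \<otimes> x = \<zero>"
  using nu_l_distr[of \<zero> \<zero> x] nu_m_closed[of \<zero> x] by (simp add: add.l_cancel_one')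

lemma nu_r_null: "x \<in> carrier R \<Longrightarrow> x \<otimes> \<zero> = \<zero>"
  using nu_r_distr[of \<zero> \<zero> x] nu_m_closed[of x \<zero>] by (simp add: add.l_cancel_one')

lemma mult_right_hom: "y \<in> carrier R \<Longrightarrow> (\<lambda>x. x \<otimes> y) \<in> hom (add_monoid R) (add_monoid R)"
  by (intro homI) (simp_all add: nu_m_closed nu_l_distr)

lemma nu_finsum_ldistr:
  assumes "y \<in> carrier R" "f \<in> A \<rightarrow> carrier R"
  shows "(\<Oplus>i\<in>A. f i) \<otimes> y = (\<Oplus>i\<in>A. f i \<otimes> y)"
  using hom_finprod[OF a_comm_group a_comm_group mult_right_hom[OF assms(1)]] assms(2)
  by (simp add: finsum_def)

end

section \<open>Additivity in the tensor square\<close>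

context nonunital_ring_extension
begin

lemma coset_hom:
  "(\<lambda>f. tensor_kernel S T #>\<^bsub>tensor_free S\<^esub> f) \<in> hom (tensor_free S) (tensor_square S T)"
proof -
  have "tensor_kernel S T \<lhd> tensor_free S"
    by (simp add: comm_group.normal_iff_subgroup comm_group_tensor_free subgroup_tensor_kernel)
  from normal.r_coset_hom_Mod[OF this] show ?thesis
    unfolding tensor_square_def .
qed

lemma tensor_square_cases:
  assumes "c \<in> carrier (tensor_square S T)"
  obtains f where "f \<in> carrier (tensor_free S)" "c = tensor_kernel S T #>\<^bsub>tensor_free S\<^esub> f"
  using assms by (auto simp: tensor_square_def FactGroup_def RCOSETS_def)

lemma coset_mult:
  "\<lbrakk>f \<in> carrier (tensor_free S); g \<in> carrier (tensor_free S)\<rbrakk> \<Longrightarrow>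
    (tensor_kernel S T #>\<^bsub>tensor_free S\<^esub> f) \<otimes>\<^bsub>tensor_square S T\<^esub> (tensor_kernel S T #>\<^bsub>tensor_free S\<^esub> g)
      = tensor_kernel S T #>\<^bsub>tensor_free S\<^esub> (f + g)"
  using hom_mult[OF coset_hom] by (simp add: mult_tensor_free)

lemma pure_tensor_closed [intro, simp]:
  "\<lbrakk>x \<in> carrier S; y \<in> carrier S\<rbrakk> \<Longrightarrow> pure_tensor S T x y \<in> carrier (tensor_square S T)"
  unfolding pure_tensor_def by (rule hom_in_carrier[OF coset_hom]) (rule frag_of_in_tensor_free)

lemma add_in_tensor_free:
  "\<lbrakk>f \<in> carrier (tensor_free S); g \<in> carrier (tensor_free S)\<rbrakk> \<Longrightarrow> f + g \<in> carrier (tensor_free S)"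
  using keys_add[of f g] by (auto simp: carrier_tensor_free)

lemma pure_tensor_hom_left:
  assumes y: "y \<in> carrier S"
  shows "(\<lambda>x. pure_tensor S T x y) \<in> hom (add_monoid S) (tensor_square S T)"
proof (rule homI)
  fix x x' assume x: "x \<in> carrier (add_monoid S)" "x' \<in> carrier (add_monoid S)"
  \<comment> \<open>\<open>coset_eqI\<close> compares two group elements, so the subtracted terms
    are grouped into one sum; \<open>diff_diff_eq\<close> brings the difference back to the shape of
    a defining relation.\<close>
  have "frag_of (x \<oplus> x', y) - (frag_of (x, y) + frag_of (x', y)) \<in> tensor_relations S T"
    unfolding tensor_relations_def diff_diff_eq[symmetric] using x y by auto
  from coset_eqI[OF this] x y
  show "pure_tensor S T (x \<otimes>\<^bsub>add_monoid S\<^esub> x') y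
      = pure_tensor S T x y \<otimes>\<^bsub>tensor_square S T\<^esub> pure_tensor S T x' y"
    by (simp add: pure_tensor_def coset_mult frag_of_in_tensor_free add_in_tensor_free)
qed (use y in simp)

lemma pure_tensor_hom_right:
  assumes x: "x \<in> carrier S"
  shows "(\<lambda>y. pure_tensor S T x y) \<in> hom (add_monoid S) (tensor_square S T)"
proof (rule homI)
  fix y y' assume y: "y \<in> carrier (add_monoid S)" "y' \<in> carrier (add_monoid S)"
  have "frag_of (x, y \<oplus> y') - (frag_of (x, y) + frag_of (x, y')) \<in> tensor_relations S T"
    unfolding tensor_relations_def diff_diff_eq[symmetric] using x y by auto
  from coset_eqI[OF this] x y
  show "pure_tensor S T x (y \<otimes>\<^bsub>add_monoid S\<^esub> y')
      = pure_tensor S T x y \<otimes>\<^bsub>tensor_square S T\<^esub> pure_tensor S T x y'"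
    by (simp add: pure_tensor_def coset_mult frag_of_in_tensor_free add_in_tensor_free)
qed (use x in simp)

lemma pure_tensor_balanced:
  assumes "x \<in> carrier S" "t \<in> T" "y \<in> carrier S"
  shows "pure_tensor S T (x \<otimes> t) y = pure_tensor S T x (t \<otimes> y)"
  unfolding pure_tensor_def
proof (rule coset_eqI)
  show "frag_of (x \<otimes> t, y) - frag_of (x, t \<otimes> y) \<in> tensor_relations S T"
    unfolding tensor_relations_def using assms by blast
qed (use assms a_subset nu_m_closed in \<open>auto intro!: frag_of_in_tensor_free\<close>)

text \<open>The unit on the right is the zero tensor. This is what allows index sets of tensor sums
  to be enlarged.\<close>

lemma pure_tensor_zero_left:
  "y \<in> carrier S \<Longrightarrow> pure_tensor S T \<zero> y = \<one>\<^bsub>tensor_square S T\<^esub>"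
  using hom_one[OF pure_tensor_hom_left] group_tensor_square a_group
  by (simp add: comm_group_def)

lemma pure_tensor_finsum_left:
  assumes "y \<in> carrier S" "f \<in> A \<rightarrow> carrier S"
  shows "pure_tensor S T (\<Oplus>i\<in>A. f i) y = (\<Otimes>\<^bsub>tensor_square S T\<^esub>i\<in>A. pure_tensor S T (f i) y)"
  using hom_finprod[OF a_comm_group group_tensor_square pure_tensor_hom_left[OF assms(1)]] assms(2)
  by (simp add: finsum_def)

lemma pure_tensor_finsum_right:
  assumes "x \<in> carrier S" "f \<in> A \<rightarrow> carrier S"
  shows "pure_tensor S T x (\<Oplus>i\<in>A. f i) = (\<Otimes>\<^bsub>tensor_square S T\<^esub>i\<in>A. pure_tensor S T x (f i))"
  using hom_finprod[OF a_comm_group group_tensor_square pure_tensor_hom_right[OF assms(1)]] assms(2)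
  by (simp add: finsum_def)

text \<open>On a coset the map is \<open>free_mult\<close> of any representative, so additivity
  descends from the free abelian group.\<close>

lemma tensor_mult_hom: "tensor_mult S \<in> hom (tensor_square S T) (add_monoid S)"
proof (rule homI)
  fix c assume "c \<in> carrier (tensor_square S T)"
  then show "tensor_mult S c \<in> carrier (add_monoid S)"
    by (metis tensor_square_cases tensor_mult_coset hom_in_carrier[OF free_mult_hom])
  fix d assume "d \<in> carrier (tensor_square S T)"
  with \<open>c \<in> _\<close> show "tensor_mult S (c \<otimes>\<^bsub>tensor_square S T\<^esub> d)
      = tensor_mult S c \<otimes>\<^bsub>add_monoid S\<^esub> tensor_mult S d"
    using hom_mult[OF free_mult_hom]
    by (elim tensor_square_cases)
      (simp add: coset_mult tensor_mult_coset add_in_tensor_free mult_tensor_free)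
qed

lemma frag_extend_closed:
  assumes "\<And>p. p \<in> carrier S \<times> carrier S \<Longrightarrow> b p \<in> carrier (tensor_free S)"
    and "f \<in> carrier (tensor_free S)"
  shows "frag_extend b f \<in> carrier (tensor_free S)"
  using assms keys_frag_extend[of b f] unfolding carrier_tensor_free by blast

text \<open>On representatives the action is the additive extension of a map on generators.
  Additivity lets the action be evaluated termwise on a sum of pure tensors; the right action is
  treated in the same way.\<close>

lemma tensor_lact_hom:
  assumes s: "s \<in> carrier S"
  shows "tensor_lact S T s \<in> hom (tensor_square S T) (tensor_square S T)"
proof -
  let ?e = "frag_extend (\<lambda>(x, y). frag_of (s \<otimes> x, y))"
  have e: "?e f \<in> carrier (tensor_free S)" if "f \<in> carrier (tensor_free S)" for f
    by (rule frag_extend_closed) (use that s nu_m_closed in \<open>auto intro!: frag_of_in_tensor_free\<close>)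
  show ?thesis
  proof (rule homI)
    fix c assume "c \<in> carrier (tensor_square S T)"
    then show "tensor_lact S T s c \<in> carrier (tensor_square S T)"
      by (elim tensor_square_cases)
        (auto simp: tensor_lact_coset s intro!: hom_in_carrier[OF coset_hom] e)
    fix d assume "d \<in> carrier (tensor_square S T)"
    with \<open>c \<in> _\<close> show "tensor_lact S T s (c \<otimes>\<^bsub>tensor_square S T\<^esub> d)
        = tensor_lact S T s c \<otimes>\<^bsub>tensor_square S T\<^esub> tensor_lact S T s d"
      by (elim tensor_square_cases)
        (simp add: coset_mult tensor_lact_coset s e add_in_tensor_free frag_extend_add)
  qed
qed

lemma tensor_ract_hom:
  assumes s: "s \<in> carrier S"
  shows "(\<lambda>c. tensor_ract S T c s) \<in> hom (tensor_square S T) (tensor_square S T)"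
proof -
  let ?e = "frag_extend (\<lambda>(x, y). frag_of (x, y \<otimes> s))"
  have e: "?e f \<in> carrier (tensor_free S)" if "f \<in> carrier (tensor_free S)" for f
    by (rule frag_extend_closed) (use that s nu_m_closed in \<open>auto intro!: frag_of_in_tensor_free\<close>)
  show ?thesis
  proof (rule homI)
    fix c assume "c \<in> carrier (tensor_square S T)"
    then show "tensor_ract S T c s \<in> carrier (tensor_square S T)"
      by (elim tensor_square_cases)
        (auto simp: tensor_ract_coset s intro!: hom_in_carrier[OF coset_hom] e)
    fix d assume "d \<in> carrier (tensor_square S T)"
    with \<open>c \<in> _\<close> show "tensor_ract S T (c \<otimes>\<^bsub>tensor_square S T\<^esub> d) s
        = tensor_ract S T c s \<otimes>\<^bsub>tensor_square S T\<^esub> tensor_ract S T d s"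
      by (elim tensor_square_cases)
        (simp add: coset_mult tensor_ract_coset s e add_in_tensor_free frag_extend_add)
  qed
qed

section \<open>A dual basis criterion for separability\<close>

text \<open>The sum of all \<open>a j\<close> tensor \<open>b j\<close> acts as a formal
  separability element: for infinite \<open>J\<close> it need not exist in the tensor square, but
  after left multiplication by \<open>x\<close> only finitely many terms survive. Hypothesis
  \<open>sum\<close> makes this a section of the multiplication, and \<open>coeff\<close> yields
  right linearity.\<close>

lemma separable_if_dual_basis:
  assumes a: "\<And>j. j \<in> J \<Longrightarrow> a j \<in> carrier S" and b: "\<And>j. j \<in> J \<Longrightarrow> b j \<in> carrier S"
    and fin: "\<And>x. x \<in> carrier S \<Longrightarrow> finite {j \<in> J. x \<otimes> a j \<noteq> \<zero>}"
    and sum: "\<And>x. x \<in> carrier S \<Longrightarrow> (\<Oplus>j\<in>{j \<in> J. x \<otimes> a j \<noteq> \<zero>}. (x \<otimes> a j) \<otimes> b j) = x"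
    and coeff: "\<And>s j l. \<lbrakk>s \<in> carrier S; j \<in> J; l \<in> J\<rbrakk> \<Longrightarrow> (b j \<otimes> s) \<otimes> a l \<in> T"
  shows "separable_extension S T"
proof -
  let ?Q = "tensor_square S T"
  interpret Q: comm_group ?Q by (rule group_tensor_square)
  define supp where "supp x = {j \<in> J. x \<otimes> a j \<noteq> \<zero>}" for x
  define \<delta> where "\<delta> x = (\<Otimes>\<^bsub>?Q\<^esub>j\<in>supp x. pure_tensor S T (x \<otimes> a j) (b j))" for x
  have supp: "j \<in> supp x \<Longrightarrow> j \<in> J" "supp x \<subseteq> J" "x \<in> carrier S \<Longrightarrow> finite (supp x)" for x j
    using fin by (auto simp: supp_def)
  have xa: "x \<otimes> a j \<in> carrier S" if "x \<in> carrier S" "j \<in> J" for x j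
    using that a nu_m_closed by simp
  \<comment> \<open>The support depends on the argument, so values of \<open>\<delta>\<close> at
    different arguments can only be compared over a common larger index set; the additional terms
    are zero tensors.\<close>
  have \<delta>_eq: "\<delta> x = (\<Otimes>\<^bsub>?Q\<^esub>j\<in>A. pure_tensor S T (x \<otimes> a j) (b j))"
    if "x \<in> carrier S" "finite A" "supp x \<subseteq> A" "A \<subseteq> J" for x A
    unfolding \<delta>_def
    by (rule Q.finprod_mono_neutral_cong_left)
      (use that in \<open>auto simp: supp_def pure_tensor_zero_left b subset_iff xa\<close>)
  have sum_eq: "(\<Oplus>j\<in>A. (x \<otimes> a j) \<otimes> b j) = x"
    if "x \<in> carrier S" "finite A" "supp x \<subseteq> A" "A \<subseteq> J" for x A
  proof -
    have "(\<Oplus>j\<in>supp x. (x \<otimes> a j) \<otimes> b j) = (\<Oplus>j\<in>A. (x \<otimes> a j) \<otimes> b j)"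
      by (rule add.finprod_mono_neutral_cong_left)
        (use that in \<open>auto simp: supp_def nu_l_null nu_m_closed b subset_iff xa\<close>)
    then show ?thesis using sum that by (simp add: supp_def)
  qed
  have "\<delta> \<in> hom (add_monoid S) ?Q"
  proof (rule homI)
    fix x assume "x \<in> carrier (add_monoid S)"
    then have x: "x \<in> carrier S" by simp
    then show "\<delta> x \<in> carrier ?Q"
      unfolding \<delta>_def using supp(1) xa b by (intro Q.finprod_closed) auto
    fix y assume "y \<in> carrier (add_monoid S)"
    then have y: "y \<in> carrier S" by simp
    \<comment> \<open>A single finite index set that serves all three values of
      \<open>\<delta>\<close>.\<close>
    let ?A = "supp x \<union> supp y \<union> supp (x \<oplus> y)"
    have A: "finite ?A" "?A \<subseteq> J" using supp x y by auto
    have "\<delta> (x \<oplus> y) = (\<Otimes>\<^bsub>?Q\<^esub>j\<in>?A. pure_tensor S T ((x \<oplus> y) \<otimes> a j) (b j))"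
      using A x y by (intro \<delta>_eq) auto
    also have "\<dots> = (\<Otimes>\<^bsub>?Q\<^esub>j\<in>?A. pure_tensor S T (x \<otimes> a j) (b j) \<otimes>\<^bsub>?Q\<^esub>
        pure_tensor S T (y \<otimes> a j) (b j))"
    proof (rule Q.finprod_cong')
      fix j assume "j \<in> ?A"
      then have "j \<in> J" using A by blast
      then show "pure_tensor S T ((x \<oplus> y) \<otimes> a j) (b j) = pure_tensor S T (x \<otimes> a j) (b j) \<otimes>\<^bsub>?Q\<^esub>
          pure_tensor S T (y \<otimes> a j) (b j)"
        using hom_mult[OF pure_tensor_hom_left[OF b], of j "x \<otimes> a j" "y \<otimes> a j"] x y a xa
        by (simp add: nu_l_distr)
    qed (use A x y xa b in auto)
    also have "\<dots> = \<delta> x \<otimes>\<^bsub>?Q\<^esub> \<delta> y"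
      using A x y xa b
      by (subst (1 2) \<delta>_eq[where A = ?A]) (auto intro!: Q.finprod_multf)
    finally show "\<delta> (x \<otimes>\<^bsub>add_monoid S\<^esub> y) = \<delta> x \<otimes>\<^bsub>?Q\<^esub> \<delta> y" by simp
  qed
  moreover have "\<delta> (s \<otimes> x) = tensor_lact S T s (\<delta> x)" if s: "s \<in> carrier S" and x: "x \<in> carrier S" for s x
  proof -
    have sub: "supp (s \<otimes> x) \<subseteq> supp x"
      using s x a by (auto simp: supp_def nu_m_assoc nu_r_null)
    have "tensor_lact S T s (\<delta> x)
        = (\<Otimes>\<^bsub>?Q\<^esub>j\<in>supp x. tensor_lact S T s (pure_tensor S T (x \<otimes> a j) (b j)))"
      unfolding \<delta>_def using supp(1) x xa b
      by (intro hom_finprod group_tensor_square tensor_lact_hom s) auto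
    also have "\<dots> = (\<Otimes>\<^bsub>?Q\<^esub>j\<in>supp x. pure_tensor S T ((s \<otimes> x) \<otimes> a j) (b j))"
      by (rule Q.finprod_cong')
        (use supp(1) s x xa a b in \<open>auto simp: tensor_act_pure nu_m_assoc nu_m_closed subset_iff\<close>)
    also have "\<dots> = \<delta> (s \<otimes> x)"
      using \<delta>_eq[of "s \<otimes> x" "supp x"] supp s x sub by (simp add: nu_m_closed)
    finally show ?thesis by simp
  qed
  moreover have "\<delta> (x \<otimes> s) = tensor_ract S T (\<delta> x) s" if s: "s \<in> carrier S" and x: "x \<in> carrier S" for s x
  proof -
    \<comment> \<open>\<open>L\<close> must carry the expansions of all
      \<open>b j \<otimes> s\<close> at once, so that the double sum has a rectangular index set,
      and also the final sum for \<open>\<delta> (x \<otimes> s)\<close>.\<close>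
    define L where "L = supp (x \<otimes> s) \<union> (\<Union>j\<in>supp x. supp (b j \<otimes> s))"
    have bs: "b j \<otimes> s \<in> carrier S" if "j \<in> J" for j
      using that b s nu_m_closed by simp
    have L: "finite L" "L \<subseteq> J"
      unfolding L_def using supp x s bs nu_m_closed by (auto simp: subset_iff)
    have expand: "b j \<otimes> s = (\<Oplus>l\<in>L. ((b j \<otimes> s) \<otimes> a l) \<otimes> b l)" if "j \<in> supp x" for j
      by (rule sum_eq[symmetric]) (use that L bs supp(1) in \<open>auto simp: L_def subset_iff\<close>)
    \<comment> \<open>The balancing relation over \<open>T\<close> enters here: by
      \<open>coeff\<close> the coefficient lies in \<open>T\<close> and may cross the tensor
      sign.\<close>
    have balance: "pure_tensor S T ((x \<otimes> a j) \<otimes> ((b j \<otimes> s) \<otimes> a l)) (b l)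
        = pure_tensor S T (x \<otimes> a j) (((b j \<otimes> s) \<otimes> a l) \<otimes> b l)" if "j \<in> J" "l \<in> J" for j l
      using that x s by (intro pure_tensor_balanced coeff xa b)
    \<comment> \<open>Regrouping isolates \<open>(x \<otimes> a j) \<otimes> b j\<close>, whose sum
      over \<open>j\<close> is \<open>x\<close>.\<close>
    have assoc: "(x \<otimes> a j) \<otimes> ((b j \<otimes> s) \<otimes> a l) = ((x \<otimes> a j) \<otimes> b j) \<otimes> (s \<otimes> a l)"
      if "j \<in> J" "l \<in> J" for j l
      using that x s a b by (simp add: nu_m_assoc nu_m_closed)
    have "tensor_ract S T (\<delta> x) s
        = (\<Otimes>\<^bsub>?Q\<^esub>j\<in>supp x. tensor_ract S T (pure_tensor S T (x \<otimes> a j) (b j)) s)"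
      unfolding \<delta>_def using supp(1) x xa b
      by (intro hom_finprod[OF _ _ tensor_ract_hom] group_tensor_square s) auto
    also have "\<dots> = (\<Otimes>\<^bsub>?Q\<^esub>j\<in>supp x. \<Otimes>\<^bsub>?Q\<^esub>l\<in>L.
        pure_tensor S T (((x \<otimes> a j) \<otimes> b j) \<otimes> (s \<otimes> a l)) (b l))"
    proof (rule Q.finprod_cong')
      fix j assume j: "j \<in> supp x"
      then have jJ: "j \<in> J" using supp(1) by blast
      have "tensor_ract S T (pure_tensor S T (x \<otimes> a j) (b j)) s
          = pure_tensor S T (x \<otimes> a j) (\<Oplus>l\<in>L. ((b j \<otimes> s) \<otimes> a l) \<otimes> b l)"
        using jJ x s xa b expand[OF j] by (simp add: tensor_act_pure)
      also have "\<dots> = (\<Otimes>\<^bsub>?Q\<^esub>l\<in>L. pure_tensor S T (x \<otimes> a j) (((b j \<otimes> s) \<otimes> a l) \<otimes> b l))"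
        by (rule pure_tensor_finsum_right) (use jJ x xa L bs b nu_m_closed in auto)
      also have "\<dots> = (\<Otimes>\<^bsub>?Q\<^esub>l\<in>L. pure_tensor S T (((x \<otimes> a j) \<otimes> b j) \<otimes> (s \<otimes> a l)) (b l))"
        by (rule Q.finprod_cong')
          (use jJ L balance assoc x s xa b nu_m_closed in \<open>auto simp: subset_iff\<close>)
      finally show "tensor_ract S T (pure_tensor S T (x \<otimes> a j) (b j)) s
          = (\<Otimes>\<^bsub>?Q\<^esub>l\<in>L. pure_tensor S T (((x \<otimes> a j) \<otimes> b j) \<otimes> (s \<otimes> a l)) (b l))" .
    qed (use supp(1) L x s xa b nu_m_closed in \<open>auto intro!: Q.finprod_closed simp: subset_iff\<close>)
    \<comment> \<open>With the sum over \<open>j\<close> innermost, and \<open>b l\<close> constant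
      in it, the left factors can be added up: they give \<open>x\<close> times
      \<open>s \<otimes> a l\<close>.\<close>
    also have "\<dots> = (\<Otimes>\<^bsub>?Q\<^esub>l\<in>L. \<Otimes>\<^bsub>?Q\<^esub>j\<in>supp x.
        pure_tensor S T (((x \<otimes> a j) \<otimes> b j) \<otimes> (s \<otimes> a l)) (b l))"
      using supp x s L a b
      by (intro Q.finprod_swap) (auto intro!: pure_tensor_closed nu_m_closed simp: subset_iff)
    also have "\<dots> = (\<Otimes>\<^bsub>?Q\<^esub>l\<in>L. pure_tensor S T ((x \<otimes> s) \<otimes> a l) (b l))"
    proof (rule Q.finprod_cong')
      fix l assume "l \<in> L"
      then have l: "l \<in> J" using L by blast
      have f: "(\<lambda>j. (x \<otimes> a j) \<otimes> b j) \<in> supp x \<rightarrow> carrier S"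
        using supp(1) x xa b nu_m_closed by (auto simp: subset_iff)
      have sa: "s \<otimes> a l \<in> carrier S" using s l xa by simp
      have "(x \<otimes> s) \<otimes> a l = (\<Oplus>j\<in>supp x. (x \<otimes> a j) \<otimes> b j) \<otimes> (s \<otimes> a l)"
        using sum_eq[of x "supp x"] supp x s l a by (simp add: nu_m_assoc)
      also have "\<dots> = (\<Oplus>j\<in>supp x. ((x \<otimes> a j) \<otimes> b j) \<otimes> (s \<otimes> a l))"
        by (rule nu_finsum_ldistr[OF sa f])
      finally show "(\<Otimes>\<^bsub>?Q\<^esub>j\<in>supp x. pure_tensor S T (((x \<otimes> a j) \<otimes> b j) \<otimes> (s \<otimes> a l)) (b l))
          = pure_tensor S T ((x \<otimes> s) \<otimes> a l) (b l)"
        using pure_tensor_finsum_left[OF b[OF l], of "\<lambda>j. ((x \<otimes> a j) \<otimes> b j) \<otimes> (s \<otimes> a l)" "supp x"]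
          f sa nu_m_closed by (simp add: Pi_iff)
    qed (use L x s xa b nu_m_closed in \<open>auto simp: subset_iff\<close>)
    also have "\<dots> = \<delta> (x \<otimes> s)"
      by (rule \<delta>_eq[symmetric]) (use x s L nu_m_closed in \<open>auto simp: L_def\<close>)
    finally show ?thesis by simp
  qed
  moreover have "tensor_mult S (\<delta> x) = x" if x: "x \<in> carrier S" for x
  proof -
    have "tensor_mult S (\<delta> x)
        = (\<Otimes>\<^bsub>add_monoid S\<^esub>j\<in>supp x. tensor_mult S (pure_tensor S T (x \<otimes> a j) (b j)))"
      unfolding \<delta>_def using supp(1) x xa b
      by (intro hom_finprod[OF _ _ tensor_mult_hom] group_tensor_square a_comm_group) auto
    also have "\<dots> = (\<Oplus>j\<in>supp x. (x \<otimes> a j) \<otimes> b j)"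
      unfolding finsum_def[symmetric]
      by (rule finsum_cong')
        (use supp(1) x xa b nu_m_closed in \<open>auto simp: tensor_mult_pure subset_iff\<close>)
    also have "\<dots> = x"
      using sum[OF x] by (simp add: supp_def)
    finally show ?thesis .
  qed
  ultimately have "bimodule_section S T \<delta>"
    by (simp add: bimodule_section_def)
  then show ?thesis
    using nonunital_ring_extension_axioms unfolding separable_extension_def by blast
qed

end

section \<open>The ring of finite matrices\<close>

context ring
begin

section \<open>Entries and supports of finite matrices\<close>

abbreviation fin_matrices :: "'i set \<Rightarrow> ('i \<times> 'i \<Rightarrow> 'a) ring" where
  "fin_matrices I \<equiv> groupoid_ring R (pair_groupoid I)"

lemma support_pair_groupoid: "support R (pair_groupoid I) x = {p \<in> I \<times> I. x p \<noteq> \<zero>}"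
  by (simp add: support_def pair_groupoid_def)

lemma carrier_fin_matrices:
  "x \<in> carrier (fin_matrices I) \<longleftrightarrow> x \<in> I \<times> I \<rightarrow>\<^sub>E carrier R \<and> finite {p \<in> I \<times> I. x p \<noteq> \<zero>}"
  by (simp add: groupoid_ring_def support_pair_groupoid) (simp add: pair_groupoid_def)

lemma fin_matrices_closed:
  "\<lbrakk>x \<in> carrier (fin_matrices I); i \<in> I; j \<in> I\<rbrakk> \<Longrightarrow> x (i, j) \<in> carrier R"
  by (auto simp: carrier_fin_matrices)

lemma fin_matrices_eqI:
  assumes "x \<in> carrier (fin_matrices I)" "y \<in> carrier (fin_matrices I)"
    "\<And>i j. \<lbrakk>i \<in> I; j \<in> I\<rbrakk> \<Longrightarrow> x (i, j) = y (i, j)"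
  shows "x = y"
  by (rule PiE_ext[of _ "I \<times> I" "\<lambda>_. carrier R"]) (use assms in \<open>auto simp: carrier_fin_matrices\<close>)

text \<open>\<open>J\<close> is the projection of the finite support to the column index. Such sets,
  and their row analogues, provide the finite ranges of summation for matrix products.\<close>

lemma fin_matrices_cols:
  assumes "x \<in> carrier (fin_matrices I)"
  obtains J where "finite J" "J \<subseteq> I" "\<And>i j. \<lbrakk>i \<in> I; j \<in> I - J\<rbrakk> \<Longrightarrow> x (i, j) = \<zero>"
proof
  show "finite (snd ` {p \<in> I \<times> I. x p \<noteq> \<zero>})" using assms by (simp add: carrier_fin_matrices)
qed force+

lemma fin_matrices_rows:
  assumes "x \<in> carrier (fin_matrices I)"
  obtains J where "finite J" "J \<subseteq> I" "\<And>i j. \<lbrakk>i \<in> I - J; j \<in> I\<rbrakk> \<Longrightarrow> x (i, j) = \<zero>"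
proof
  show "finite (fst ` {p \<in> I \<times> I. x p \<noteq> \<zero>})" using assms by (simp add: carrier_fin_matrices)
qed force+

section \<open>Additive structure of finite matrices\<close>

lemma fin_matrices_zero: "\<zero>\<^bsub>fin_matrices I\<^esub> = (\<lambda>p\<in>I \<times> I. \<zero>)"
  by (simp add: groupoid_ring_def pair_groupoid_def)

lemma fin_matrices_add: "x \<oplus>\<^bsub>fin_matrices I\<^esub> y = (\<lambda>p\<in>I \<times> I. x p \<oplus> y p)"
  by (simp add: groupoid_ring_def pair_groupoid_def)

lemma fin_matrices_zero_closed: "\<zero>\<^bsub>fin_matrices I\<^esub> \<in> carrier (fin_matrices I)"
  by (simp add: carrier_fin_matrices fin_matrices_zero cong: conj_cong)

lemma fin_matrices_add_closed:
  assumes "x \<in> carrier (fin_matrices I)" "y \<in> carrier (fin_matrices I)"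
  shows "x \<oplus>\<^bsub>fin_matrices I\<^esub> y \<in> carrier (fin_matrices I)"
proof -
  have "{p \<in> I \<times> I. x p \<oplus> y p \<noteq> \<zero>} \<subseteq> {p \<in> I \<times> I. x p \<noteq> \<zero>} \<union> {p \<in> I \<times> I. y p \<noteq> \<zero>}"
    by auto
  then have "finite {p \<in> I \<times> I. x p \<oplus> y p \<noteq> \<zero>}"
    by (rule finite_subset) (use assms in \<open>simp add: carrier_fin_matrices\<close>)
  moreover have "x p \<oplus> y p \<in> carrier R" if "p \<in> I \<times> I" for p
    using that assms by (auto simp: carrier_fin_matrices)
  ultimately show ?thesis
    by (auto simp: carrier_fin_matrices fin_matrices_add cong: conj_cong)
qed

lemma fin_matrices_uminus_closed:
  assumes "x \<in> carrier (fin_matrices I)"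
  shows "(\<lambda>p\<in>I \<times> I. \<ominus> x p) \<in> carrier (fin_matrices I)"
proof -
  have "finite {p \<in> I \<times> I. \<ominus> x p \<noteq> \<zero>}"
    by (rule finite_subset[of _ "{p \<in> I \<times> I. x p \<noteq> \<zero>}"])
      (use assms in \<open>auto simp: carrier_fin_matrices\<close>)
  with assms show ?thesis
    by (auto simp: carrier_fin_matrices Pi_iff PiE_iff cong: conj_cong)
qed

section \<open>Matrix multiplication\<close>

text \<open>The arrows composing to \<open>(i, l)\<close> are the pairs \<open>(i, j)\<close>,
  \<open>(j, l)\<close>, so the groupoid product is row times column. Leaving \<open>J\<close> free
  allows the columns of \<open>x\<close>, the rows of \<open>y\<close>, a singleton or the empty set
  to be used as convenient.\<close>

lemma fin_matrices_mult_entry: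
  assumes x: "x \<in> carrier (fin_matrices I)" and y: "y \<in> carrier (fin_matrices I)"
    and J: "finite J" "J \<subseteq> I" and il: "i \<in> I" "l \<in> I"
    and zero: "\<And>j. j \<in> I - J \<Longrightarrow> x (i, j) \<otimes> y (j, l) = \<zero>"
  shows "(x \<otimes>\<^bsub>fin_matrices I\<^esub> y) (i, l) = (\<Oplus>j\<in>J. x (i, j) \<otimes> y (j, l))"
proof -
  let ?h = "\<lambda>j. ((i, j), (j, l))"
  let ?f = "\<lambda>p. x (fst p) \<otimes> y (snd p)"
  \<comment> \<open>\<open>K\<close> indexes the composable pairs in the two supports, which is
    exactly the range of summation in the definition of the product.\<close>
  define K where "K = {j \<in> I. x (i, j) \<noteq> \<zero> \<and> y (j, l) \<noteq> \<zero>}"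
  have "finite {p \<in> I \<times> I. x p \<noteq> \<zero>}" using x by (simp add: carrier_fin_matrices)
  then have "finite (snd ` {p \<in> I \<times> I. x p \<noteq> \<zero>})" by simp
  then have K: "finite K" by (rule finite_subset[rotated]) (use il in \<open>force simp: K_def\<close>)
  have "{p \<in> {p \<in> I \<times> I. x p \<noteq> \<zero>} \<times> {p \<in> I \<times> I. y p \<noteq> \<zero>}.
      gcomp (pair_groupoid I) (fst p) (snd p) = Some (i, l)} = ?h ` K"
    using il by (auto simp: pair_groupoid_def K_def image_iff split: if_splits)
  then have "(x \<otimes>\<^bsub>fin_matrices I\<^esub> y) (i, l) = finsum R ?f (?h ` K)"
    using il by (simp add: groupoid_ring_def support_pair_groupoid) (simp add: pair_groupoid_def)
  also have "\<dots> = (\<Oplus>j\<in>K. x (i, j) \<otimes> y (j, l))"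
    using x y il by (subst finsum_reindex) (auto simp: K_def inj_on_def fin_matrices_closed)
  \<comment> \<open>Neither set need contain the other, since zero divisors can leave an index of
    \<open>K\<close> outside \<open>J\<close>. Hence the detour through the union: terms outside
    \<open>K\<close> have a zero factor, those outside \<open>J\<close> vanish by
    \<open>zero\<close>.\<close>
  also have "\<dots> = (\<Oplus>j\<in>K \<union> J. x (i, j) \<otimes> y (j, l))"
  proof (rule add.finprod_mono_neutral_cong_left)
    fix j assume "j \<in> K \<union> J - K"
    then have "j \<in> I" "x (i, j) = \<zero> \<or> y (j, l) = \<zero>" using J by (auto simp: K_def)
    then show "x (i, j) \<otimes> y (j, l) = \<zero>"
      using x y il by (auto simp: fin_matrices_closed)
  qed (use K J x y il in \<open>auto simp: K_def fin_matrices_closed subset_iff\<close>)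
  also have "\<dots> = (\<Oplus>j\<in>J. x (i, j) \<otimes> y (j, l))"
    by (rule add.finprod_mono_neutral_cong_right)
      (use K J x y il zero in \<open>auto simp: K_def fin_matrices_closed subset_iff\<close>)
  finally show ?thesis .
qed

text \<open>The support of the product lies in the finite rectangle \<open>A \<times> C\<close>
  spanned by the nonzero rows of \<open>x\<close> and the nonzero columns of
  \<open>y\<close>.\<close>

lemma fin_matrices_mult_closed:
  assumes x: "x \<in> carrier (fin_matrices I)" and y: "y \<in> carrier (fin_matrices I)"
  shows "x \<otimes>\<^bsub>fin_matrices I\<^esub> y \<in> carrier (fin_matrices I)"
proof -
  let ?z = "x \<otimes>\<^bsub>fin_matrices I\<^esub> y"
  obtain J where J: "finite J" "J \<subseteq> I" "\<And>i j. \<lbrakk>i \<in> I; j \<in> I - J\<rbrakk> \<Longrightarrow> x (i, j) = \<zero>"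
    using fin_matrices_cols[OF x] by blast
  obtain A where A: "finite A" "A \<subseteq> I" "\<And>i j. \<lbrakk>i \<in> I - A; j \<in> I\<rbrakk> \<Longrightarrow> x (i, j) = \<zero>"
    using fin_matrices_rows[OF x] by blast
  obtain C where C: "finite C" "C \<subseteq> I" "\<And>i j. \<lbrakk>i \<in> I; j \<in> I - C\<rbrakk> \<Longrightarrow> y (i, j) = \<zero>"
    using fin_matrices_cols[OF y] by blast
  have entry: "?z (i, l) = (\<Oplus>j\<in>J. x (i, j) \<otimes> y (j, l))" if "i \<in> I" "l \<in> I" for i l
    using that x y J by (intro fin_matrices_mult_entry) (auto simp: fin_matrices_closed)
  have "?z (i, l) \<in> carrier R" if "i \<in> I" "l \<in> I" for i l
    using that x y J by (auto simp: entry fin_matrices_closed subset_iff intro!: finsum_closed)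
  moreover have "?z (i, l) = \<zero>" if "i \<in> I" "l \<in> I" "(i, l) \<notin> A \<times> C" for i l
  proof -
    have "x (i, j) \<otimes> y (j, l) = \<zero>" if "j \<in> J" for j
    proof -
      have "j \<in> I" using that J by blast
      moreover have "x (i, j) = \<zero> \<or> y (j, l) = \<zero>"
        using \<open>j \<in> I\<close> \<open>i \<in> I\<close> \<open>l \<in> I\<close> \<open>(i, l) \<notin> A \<times> C\<close> A(3) C(3) by blast
      ultimately show ?thesis
        using x y \<open>i \<in> I\<close> \<open>l \<in> I\<close> by (auto simp: fin_matrices_closed)
    qed
    then show ?thesis using that by (simp add: entry add.finprod_one_eqI)
  qed
  then have "{p \<in> I \<times> I. ?z p \<noteq> \<zero>} \<subseteq> A \<times> C" by blast
  then have "finite {p \<in> I \<times> I. ?z p \<noteq> \<zero>}"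
    using A(1) C(1) by (meson finite_SigmaI finite_subset)
  moreover have "?z \<in> extensional (I \<times> I)"
    by (simp add: groupoid_ring_def pair_groupoid_def)
  ultimately show ?thesis
    by (auto simp: carrier_fin_matrices PiE_iff)
qed

text \<open>Both sides become the same double sum over \<open>J\<close>, containing the nonzero
  columns of \<open>x\<close>, and \<open>K\<close>, containing those of \<open>y\<close>.\<close>

lemma fin_matrices_assoc:
  assumes x: "x \<in> carrier (fin_matrices I)" and y: "y \<in> carrier (fin_matrices I)"
    and z: "z \<in> carrier (fin_matrices I)"
  shows "(x \<otimes>\<^bsub>fin_matrices I\<^esub> y) \<otimes>\<^bsub>fin_matrices I\<^esub> z = x \<otimes>\<^bsub>fin_matrices I\<^esub> (y \<otimes>\<^bsub>fin_matrices I\<^esub> z)"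
proof (rule fin_matrices_eqI)
  fix i l assume il: "i \<in> I" "l \<in> I"
  let ?xy = "x \<otimes>\<^bsub>fin_matrices I\<^esub> y" and ?yz = "y \<otimes>\<^bsub>fin_matrices I\<^esub> z"
  obtain J where J: "finite J" "J \<subseteq> I" "\<And>i j. \<lbrakk>i \<in> I; j \<in> I - J\<rbrakk> \<Longrightarrow> x (i, j) = \<zero>"
    using fin_matrices_cols[OF x] by blast
  obtain K where K: "finite K" "K \<subseteq> I" "\<And>i j. \<lbrakk>i \<in> I; j \<in> I - K\<rbrakk> \<Longrightarrow> y (i, j) = \<zero>"
    using fin_matrices_cols[OF y] by blast
  have IJ: "j \<in> I" if "j \<in> J" for j using that J by blast
  have IK: "k \<in> I" if "k \<in> K" for k using that K by blast
  note cl = fin_matrices_closed[OF x] fin_matrices_closed[OF y] fin_matrices_closed[OF z]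
  have xy: "?xy (i, k) = (\<Oplus>j\<in>J. x (i, j) \<otimes> y (j, k))" if "k \<in> I" for k
    using that il J cl by (intro fin_matrices_mult_entry x y) auto
  have yz: "?yz (j, l) = (\<Oplus>k\<in>K. y (j, k) \<otimes> z (k, l))" if "j \<in> I" for j
    using that il K cl by (intro fin_matrices_mult_entry y z) auto
  \<comment> \<open>A zero column of \<open>y\<close> gives a zero column of the product, so
    \<open>K\<close> also serves as the range of the outer sum.\<close>
  have "?xy (i, k) = \<zero>" if "k \<in> I - K" for k
    using that il K(3) IJ cl by (simp add: xy add.finprod_one_eqI)
  then have "(?xy \<otimes>\<^bsub>fin_matrices I\<^esub> z) (i, l) = (\<Oplus>k\<in>K. ?xy (i, k) \<otimes> z (k, l))"
    using il K cl by (intro fin_matrices_mult_entry fin_matrices_mult_closed x y z) auto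
  also have "\<dots> = (\<Oplus>k\<in>K. \<Oplus>j\<in>J. x (i, j) \<otimes> (y (j, k) \<otimes> z (k, l)))"
  proof (rule finsum_cong')
    fix k assume k: "k \<in> K"
    have "?xy (i, k) \<otimes> z (k, l) = (\<Oplus>j\<in>J. (x (i, j) \<otimes> y (j, k)) \<otimes> z (k, l))"
      using k il J IJ IK cl by (simp add: xy finsum_ldistr Pi_iff)
    also have "\<dots> = (\<Oplus>j\<in>J. x (i, j) \<otimes> (y (j, k) \<otimes> z (k, l)))"
      by (rule finsum_cong') (use k il IJ IK cl in \<open>auto simp: m_assoc\<close>)
    finally show "?xy (i, k) \<otimes> z (k, l) = (\<Oplus>j\<in>J. x (i, j) \<otimes> (y (j, k) \<otimes> z (k, l)))" .
  qed (use il IJ IK cl in \<open>auto intro!: finsum_closed\<close>)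
  also have "\<dots> = (\<Oplus>j\<in>J. \<Oplus>k\<in>K. x (i, j) \<otimes> (y (j, k) \<otimes> z (k, l)))"
    using J K il IJ IK cl by (intro add.finprod_swap) auto
  also have "\<dots> = (\<Oplus>j\<in>J. x (i, j) \<otimes> ?yz (j, l))"
    by (rule finsum_cong')
      (use il IJ IK cl K(1) in \<open>auto simp: yz finsum_rdistr Pi_iff intro!: finsum_closed\<close>)
  also have "\<dots> = (x \<otimes>\<^bsub>fin_matrices I\<^esub> ?yz) (i, l)"
    using il J fin_matrices_closed[OF fin_matrices_mult_closed[OF y z]]
    by (intro fin_matrices_mult_entry[symmetric] fin_matrices_mult_closed x y z) auto
  finally show "(?xy \<otimes>\<^bsub>fin_matrices I\<^esub> z) (i, l) = (x \<otimes>\<^bsub>fin_matrices I\<^esub> ?yz) (i, l)" .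
qed (simp_all add: assms fin_matrices_mult_closed)

text \<open>The ranges of summation are taken from \<open>z\<close> alone, its rows when it stands
  on the right and its columns when it stands on the left. All products being compared then share
  one range.\<close>

lemma fin_matrices_distrib:
  assumes x: "x \<in> carrier (fin_matrices I)" and y: "y \<in> carrier (fin_matrices I)"
    and z: "z \<in> carrier (fin_matrices I)"
  shows "(x \<oplus>\<^bsub>fin_matrices I\<^esub> y) \<otimes>\<^bsub>fin_matrices I\<^esub> z
      = x \<otimes>\<^bsub>fin_matrices I\<^esub> z \<oplus>\<^bsub>fin_matrices I\<^esub> y \<otimes>\<^bsub>fin_matrices I\<^esub> z" (is ?L)
    and "z \<otimes>\<^bsub>fin_matrices I\<^esub> (x \<oplus>\<^bsub>fin_matrices I\<^esub> y)
      = z \<otimes>\<^bsub>fin_matrices I\<^esub> x \<oplus>\<^bsub>fin_matrices I\<^esub> z \<otimes>\<^bsub>fin_matrices I\<^esub> y" (is ?R)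
proof -
  note cl = fin_matrices_closed[OF x] fin_matrices_closed[OF y] fin_matrices_closed[OF z]
  obtain J where J: "finite J" "J \<subseteq> I" "\<And>i j. \<lbrakk>i \<in> I; j \<in> I - J\<rbrakk> \<Longrightarrow> z (i, j) = \<zero>"
    using fin_matrices_cols[OF z] by blast
  obtain K where K: "finite K" "K \<subseteq> I" "\<And>i j. \<lbrakk>i \<in> I - K; j \<in> I\<rbrakk> \<Longrightarrow> z (i, j) = \<zero>"
    using fin_matrices_rows[OF z] by blast
  have IJ: "j \<in> I" if "j \<in> J" for j using that J by blast
  have IK: "k \<in> I" if "k \<in> K" for k using that K by blast
  have left: "(w \<otimes>\<^bsub>fin_matrices I\<^esub> z) (i, l) = (\<Oplus>k\<in>K. w (i, k) \<otimes> z (k, l))"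
    if "w \<in> carrier (fin_matrices I)" "i \<in> I" "l \<in> I" for w i l
    using that K by (intro fin_matrices_mult_entry z) (auto simp: fin_matrices_closed)
  have right: "(z \<otimes>\<^bsub>fin_matrices I\<^esub> w) (i, l) = (\<Oplus>j\<in>J. z (i, j) \<otimes> w (j, l))"
    if "w \<in> carrier (fin_matrices I)" "i \<in> I" "l \<in> I" for w i l
    using that J by (intro fin_matrices_mult_entry z) (auto simp: fin_matrices_closed)
  show ?L
  proof (rule fin_matrices_eqI)
    fix i l assume il: "i \<in> I" "l \<in> I"
    have "(\<Oplus>k\<in>K. (x \<oplus>\<^bsub>fin_matrices I\<^esub> y) (i, k) \<otimes> z (k, l))
        = (\<Oplus>k\<in>K. x (i, k) \<otimes> z (k, l) \<oplus> y (i, k) \<otimes> z (k, l))"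
      by (rule finsum_cong') (use il IK cl in \<open>auto simp: fin_matrices_add l_distr\<close>)
    also have "\<dots> = (\<Oplus>k\<in>K. x (i, k) \<otimes> z (k, l)) \<oplus> (\<Oplus>k\<in>K. y (i, k) \<otimes> z (k, l))"
      using il IK cl by (intro finsum_addf) auto
    finally show "((x \<oplus>\<^bsub>fin_matrices I\<^esub> y) \<otimes>\<^bsub>fin_matrices I\<^esub> z) (i, l)
        = (x \<otimes>\<^bsub>fin_matrices I\<^esub> z \<oplus>\<^bsub>fin_matrices I\<^esub> y \<otimes>\<^bsub>fin_matrices I\<^esub> z) (i, l)"
      using il x y left fin_matrices_add_closed[OF x y]
        fin_matrices_add[of I "x \<otimes>\<^bsub>fin_matrices I\<^esub> z" "y \<otimes>\<^bsub>fin_matrices I\<^esub> z"] by simp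
  qed (simp_all add: assms fin_matrices_mult_closed fin_matrices_add_closed)
  show ?R
  proof (rule fin_matrices_eqI)
    fix i l assume il: "i \<in> I" "l \<in> I"
    have "(\<Oplus>k\<in>J. z (i, k) \<otimes> (x \<oplus>\<^bsub>fin_matrices I\<^esub> y) (k, l))
        = (\<Oplus>k\<in>J. z (i, k) \<otimes> x (k, l) \<oplus> z (i, k) \<otimes> y (k, l))"
      by (rule finsum_cong') (use il IJ cl in \<open>auto simp: fin_matrices_add r_distr\<close>)
    also have "\<dots> = (\<Oplus>k\<in>J. z (i, k) \<otimes> x (k, l)) \<oplus> (\<Oplus>k\<in>J. z (i, k) \<otimes> y (k, l))"
      using il IJ cl by (intro finsum_addf) auto
    finally show "(z \<otimes>\<^bsub>fin_matrices I\<^esub> (x \<oplus>\<^bsub>fin_matrices I\<^esub> y)) (i, l)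
        = (z \<otimes>\<^bsub>fin_matrices I\<^esub> x \<oplus>\<^bsub>fin_matrices I\<^esub> z \<otimes>\<^bsub>fin_matrices I\<^esub> y) (i, l)"
      using il x y right fin_matrices_add_closed[OF x y]
        fin_matrices_add[of I "z \<otimes>\<^bsub>fin_matrices I\<^esub> x" "z \<otimes>\<^bsub>fin_matrices I\<^esub> y"] by simp
  qed (simp_all add: assms fin_matrices_mult_closed fin_matrices_add_closed)
qed

text \<open>Gives the inverses in the additive group, and later identifies the abstract negative
  with the entrywise one when the diagonal subring is treated.\<close>

lemma fin_matrices_neg:
  assumes "x \<in> carrier (fin_matrices I)"
  shows "(\<lambda>p\<in>I \<times> I. \<ominus> x p) \<oplus>\<^bsub>fin_matrices I\<^esub> x = \<zero>\<^bsub>fin_matrices I\<^esub>"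
  using fin_matrices_closed[OF assms]
  by (auto simp: fin_matrices_add fin_matrices_zero l_neg intro!: restrict_ext)

lemma abelian_group_fin_matrices: "abelian_group (fin_matrices I)"
proof (rule abelian_groupI)
  fix x y z
  assume x: "x \<in> carrier (fin_matrices I)" and y: "y \<in> carrier (fin_matrices I)"
    and z: "z \<in> carrier (fin_matrices I)"
  show "(x \<oplus>\<^bsub>fin_matrices I\<^esub> y) \<oplus>\<^bsub>fin_matrices I\<^esub> z = x \<oplus>\<^bsub>fin_matrices I\<^esub> (y \<oplus>\<^bsub>fin_matrices I\<^esub> z)"
    using x y z by (auto simp: fin_matrices_add fin_matrices_closed a_assoc intro!: restrict_ext)
next
  fix x y
  assume x: "x \<in> carrier (fin_matrices I)" and y: "y \<in> carrier (fin_matrices I)"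
  show "x \<oplus>\<^bsub>fin_matrices I\<^esub> y = y \<oplus>\<^bsub>fin_matrices I\<^esub> x"
    using x y by (auto simp: fin_matrices_add fin_matrices_closed a_comm intro!: restrict_ext)
next
  fix x assume x: "x \<in> carrier (fin_matrices I)"
  show "\<zero>\<^bsub>fin_matrices I\<^esub> \<oplus>\<^bsub>fin_matrices I\<^esub> x = x"
    using x fin_matrices_zero_closed
    by (intro fin_matrices_eqI[OF fin_matrices_add_closed])
      (auto simp: fin_matrices_add fin_matrices_zero fin_matrices_closed)
  show "\<exists>y\<in>carrier (fin_matrices I). y \<oplus>\<^bsub>fin_matrices I\<^esub> x = \<zero>\<^bsub>fin_matrices I\<^esub>"
    using fin_matrices_neg[OF x] fin_matrices_uminus_closed[OF x] by blast
qed (simp_all add: fin_matrices_zero_closed fin_matrices_add_closed)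

lemma nonunital_ring_fin_matrices: "nonunital_ring (fin_matrices I)"
  by (intro nonunital_ring.intro nonunital_ring_axioms.intro abelian_group_fin_matrices
      fin_matrices_mult_closed fin_matrices_assoc fin_matrices_distrib)

section \<open>The diagonal subring\<close>

text \<open>The identities of the pair groupoid are the pairs \<open>(i, i)\<close>, so the subring
  consists of the diagonal matrices.\<close>

lemma identity_subring_iff:
  "x \<in> identity_subring R (pair_groupoid I) \<longleftrightarrow>
    x \<in> carrier (fin_matrices I) \<and> (\<forall>i\<in>I. \<forall>j\<in>I. i \<noteq> j \<longrightarrow> x (i, j) = \<zero>)"
  by (auto simp: identity_subring_def support_pair_groupoid identities_pair_groupoid)

lemma ring_extension_fin_matrices:
  "nonunital_ring_extension (fin_matrices I) (identity_subring R (pair_groupoid I))"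
proof -
  interpret M: nonunital_ring "fin_matrices I" by (rule nonunital_ring_fin_matrices)
  let ?D = "identity_subring R (pair_groupoid I)"
  have "subgroup ?D (add_monoid (fin_matrices I))"
  proof (rule group.subgroupI[OF M.a_group])
    show "?D \<noteq> {}"
    proof -
      have "\<zero>\<^bsub>fin_matrices I\<^esub> \<in> ?D"
        by (simp add: identity_subring_iff fin_matrices_zero_closed) (simp add: fin_matrices_zero)
      then show ?thesis by blast
    qed
  next
    fix x assume x: "x \<in> ?D"
    then have xc: "x \<in> carrier (fin_matrices I)" by (simp add: identity_subring_iff)
    have "\<ominus>\<^bsub>fin_matrices I\<^esub> x = (\<lambda>p\<in>I \<times> I. \<ominus> x p)"
      by (rule M.minus_equality[OF fin_matrices_neg[OF xc] xc fin_matrices_uminus_closed[OF xc]])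
    then show "inv\<^bsub>add_monoid (fin_matrices I)\<^esub> x \<in> ?D"
      using x fin_matrices_uminus_closed[OF xc] by (simp add: a_inv_def identity_subring_iff)
  next
    fix x y assume "x \<in> ?D" "y \<in> ?D"
    then show "x \<otimes>\<^bsub>add_monoid (fin_matrices I)\<^esub> y \<in> ?D"
      using fin_matrices_add_closed[of x I y] by (simp add: identity_subring_iff fin_matrices_add)
  qed (auto simp: identity_subring_iff)
  moreover have "x \<otimes>\<^bsub>fin_matrices I\<^esub> y \<in> ?D" if x: "x \<in> ?D" and y: "y \<in> ?D" for x y
  proof -
    have c: "x \<in> carrier (fin_matrices I)" "y \<in> carrier (fin_matrices I)"
      using x y by (simp_all add: identity_subring_iff)
    have "(x \<otimes>\<^bsub>fin_matrices I\<^esub> y) (i, l) = \<zero>" if "i \<in> I" "l \<in> I" "i \<noteq> l" for i l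
    proof -
      have "x (i, j) \<otimes> y (j, l) = \<zero>" if "j \<in> I" for j
        using x y c \<open>i \<in> I\<close> \<open>l \<in> I\<close> \<open>i \<noteq> l\<close> that
        by (cases "i = j") (auto simp: identity_subring_iff fin_matrices_closed)
      \<comment> \<open>For \<open>i \<noteq> l\<close> every index differs from \<open>i\<close> or
        from \<open>l\<close>, so all terms vanish and the empty range is admissible.\<close>
      then show ?thesis
        using fin_matrices_mult_entry[OF c, of "{}" i l] that by simp
    qed
    then show ?thesis using c by (simp add: identity_subring_iff fin_matrices_mult_closed)
  qed
  ultimately show ?thesis
    by (intro nonunital_ring_extension.intro nonunital_ring_extension_axioms.intro
        additive_subgroup.intro nonunital_ring_fin_matrices)
qed

section \<open>Matrix units\<close>

text \<open>The restriction makes this the zero matrix when an index lies outside \<open>I\<close>,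
  so it belongs to the matrix ring for all \<open>i\<close> and \<open>j\<close>.\<close>

definition matrix_unit :: "'i set \<Rightarrow> 'i \<Rightarrow> 'i \<Rightarrow> 'i \<times> 'i \<Rightarrow> 'a" where
  "matrix_unit I i j = (\<lambda>p\<in>I \<times> I. if p = (i, j) then \<one> else \<zero>)"

lemma matrix_unit_closed: "matrix_unit I i j \<in> carrier (fin_matrices I)"
proof -
  have "finite {p \<in> I \<times> I. matrix_unit I i j p \<noteq> \<zero>}"
    by (rule finite_subset[of _ "{(i, j)}"]) (auto simp: matrix_unit_def split: if_splits)
  then show ?thesis by (auto simp: carrier_fin_matrices matrix_unit_def)
qed

text \<open>Only the index \<open>j\<close> contributes to the product: column \<open>j\<close> of
  \<open>x\<close> moves to column \<open>k\<close>. Multiplication from the left moves rows in the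
  same way.\<close>

lemma mult_matrix_unit_entry:
  assumes x: "x \<in> carrier (fin_matrices I)" and "j \<in> I" "k \<in> I" "i \<in> I" "l \<in> I"
  shows "(x \<otimes>\<^bsub>fin_matrices I\<^esub> matrix_unit I j k) (i, l) = (if l = k then x (i, j) else \<zero>)"
proof -
  have "(x \<otimes>\<^bsub>fin_matrices I\<^esub> matrix_unit I j k) (i, l)
      = (\<Oplus>m\<in>{j}. x (i, m) \<otimes> matrix_unit I j k (m, l))"
    using assms
    by (intro fin_matrices_mult_entry matrix_unit_closed) (auto simp: matrix_unit_def fin_matrices_closed)
  then show ?thesis
    using assms by (simp add: matrix_unit_def fin_matrices_closed)
qed

lemma matrix_unit_mult_entry:
  assumes x: "x \<in> carrier (fin_matrices I)" and "k \<in> I" "j \<in> I" "i \<in> I" "l \<in> I"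
  shows "(matrix_unit I k j \<otimes>\<^bsub>fin_matrices I\<^esub> x) (i, l) = (if i = k then x (j, l) else \<zero>)"
proof -
  have "(matrix_unit I k j \<otimes>\<^bsub>fin_matrices I\<^esub> x) (i, l)
      = (\<Oplus>m\<in>{j}. matrix_unit I k j (i, m) \<otimes> x (m, l))"
    using assms
    by (intro fin_matrices_mult_entry matrix_unit_closed) (auto simp: matrix_unit_def fin_matrices_closed)
  then show ?thesis
    using assms by (simp add: matrix_unit_def fin_matrices_closed)
qed

text \<open>Reading off a fixed entry is an additive homomorphism to the coefficient ring, so
  \<open>hom_finprod\<close> applies.\<close>

lemma finsum_fin_matrices_entry:
  assumes "i \<in> I" "l \<in> I" "f \<in> A \<rightarrow> carrier (fin_matrices I)"
  shows "finsum (fin_matrices I) f A (i, l) = (\<Oplus>a\<in>A. f a (i, l))"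
proof -
  have "(\<lambda>x. x (i, l)) \<in> hom (add_monoid (fin_matrices I)) (add_monoid R)"
    using assms(1,2) by (intro homI) (simp_all add: fin_matrices_closed fin_matrices_add)
  from hom_finprod[OF abelian_group.a_comm_group[OF abelian_group_fin_matrices] a_comm_group this]
  show ?thesis using assms(3) by (simp add: finsum_def)
qed

section \<open>Separability over the diagonal matrices\<close>

lemma separable_fin_matrices:
  "separable_extension (fin_matrices I) (identity_subring R (pair_groupoid I))"
proof -
  interpret M: nonunital_ring_extension "fin_matrices I" "identity_subring R (pair_groupoid I)"
    by (rule ring_extension_fin_matrices)
  \<comment> \<open>The conditional form covers the empty index set, where any \<open>k\<close> will
    do; otherwise \<open>k\<close> is some element of \<open>I\<close>.\<close>
  obtain k where k: "\<And>j. j \<in> I \<Longrightarrow> k \<in> I" by blast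
  note entries = mult_matrix_unit_entry matrix_unit_mult_entry
  note closed = fin_matrices_mult_closed matrix_unit_closed
  \<comment> \<open>Only column \<open>k\<close> of this product can be nonzero, and it is column
    \<open>j\<close> of \<open>x\<close>. The support in the criterion is therefore the set of
    nonzero columns of \<open>x\<close>.\<close>
  have col: "x \<otimes>\<^bsub>fin_matrices I\<^esub> matrix_unit I j k = \<zero>\<^bsub>fin_matrices I\<^esub> \<longleftrightarrow> (\<forall>i\<in>I. x (i, j) = \<zero>)"
    if "x \<in> carrier (fin_matrices I)" "j \<in> I" for x j
  proof
    assume "x \<otimes>\<^bsub>fin_matrices I\<^esub> matrix_unit I j k = \<zero>\<^bsub>fin_matrices I\<^esub>"
    then have "(x \<otimes>\<^bsub>fin_matrices I\<^esub> matrix_unit I j k) (i, k) = \<zero>" if "i \<in> I" for i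
      using that k by (simp add: fin_matrices_zero)
    then show "\<forall>i\<in>I. x (i, j) = \<zero>" using that k by (simp add: entries)
  next
    assume "\<forall>i\<in>I. x (i, j) = \<zero>"
    then show "x \<otimes>\<^bsub>fin_matrices I\<^esub> matrix_unit I j k = \<zero>\<^bsub>fin_matrices I\<^esub>"
      using that k
      by (intro fin_matrices_eqI[OF _ fin_matrices_zero_closed])
        (auto simp: entries closed fin_matrices_zero)
  qed
  have fin: "finite {j \<in> I. x \<otimes>\<^bsub>fin_matrices I\<^esub> matrix_unit I j k \<noteq> \<zero>\<^bsub>fin_matrices I\<^esub>}"
    if x: "x \<in> carrier (fin_matrices I)" for x
  proof -
    obtain J where J: "finite J" "J \<subseteq> I" "\<And>i j. \<lbrakk>i \<in> I; j \<in> I - J\<rbrakk> \<Longrightarrow> x (i, j) = \<zero>"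
      using fin_matrices_cols[OF x] by blast
    have "j \<in> J" if "j \<in> I" "\<exists>i\<in>I. x (i, j) \<noteq> \<zero>" for j
      using that J(3) by blast
    then show ?thesis
      by (intro finite_subset[OF _ J(1)]) (auto simp: col[OF x])
  qed
  show ?thesis
  proof (rule M.separable_if_dual_basis[of I "\<lambda>j. matrix_unit I j k" "\<lambda>j. matrix_unit I k j"])
    fix x assume x: "x \<in> carrier (fin_matrices I)"
    let ?J = "{j \<in> I. x \<otimes>\<^bsub>fin_matrices I\<^esub> matrix_unit I j k \<noteq> \<zero>\<^bsub>fin_matrices I\<^esub>}"
    let ?f = "\<lambda>j. (x \<otimes>\<^bsub>fin_matrices I\<^esub> matrix_unit I j k) \<otimes>\<^bsub>fin_matrices I\<^esub> matrix_unit I k j"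
    have f: "?f \<in> A \<rightarrow> carrier (fin_matrices I)" for A
      using x by (simp add: closed)
    show "finsum (fin_matrices I) ?f ?J = x"
    proof (rule fin_matrices_eqI[OF M.finsum_closed[OF f] x])
      fix i l assume il: "i \<in> I" "l \<in> I"
      then have kI: "k \<in> I" using k by blast
      \<comment> \<open>The two matrix units multiply to the diagonal unit at \<open>j\<close>,
        which keeps column \<open>j\<close> of \<open>x\<close> and kills the others.\<close>
      have entry: "?f j (i, l) = (if l = j then x (i, j) else \<zero>)" if "j \<in> I" for j
        using that il kI x by (simp add: entries closed)
      \<comment> \<open>If column \<open>l\<close> of \<open>x\<close> is zero, then
        \<open>l\<close> is missing from \<open>?J\<close>; adding it contributes a zero term and
        lets the sum be evaluated at the single index \<open>l\<close> in either case.\<close>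
      have "(\<Oplus>j\<in>?J. ?f j (i, l)) = (\<Oplus>j\<in>insert l ?J. ?f j (i, l))"
      proof (rule add.finprod_mono_neutral_cong_left)
        show "?f j (i, l) = \<zero>" if "j \<in> insert l ?J - ?J" for j
          using that il x by (auto simp: entry col)
      qed (use il x fin[OF x] in \<open>auto simp: entry fin_matrices_closed\<close>)
      also have "\<dots> = (\<Oplus>j\<in>insert l ?J. if l = j then x (i, j) else \<zero>)"
        by (rule finsum_cong') (use il x in \<open>auto simp: entry fin_matrices_closed\<close>)
      also have "\<dots> = x (i, l)"
        by (rule finsum_singleton) (use il x fin[OF x] in \<open>auto simp: fin_matrices_closed\<close>)
      finally show "finsum (fin_matrices I) ?f ?J (i, l) = x (i, l)"
        using finsum_fin_matrices_entry[OF il f] by simp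
    qed
  next
    \<comment> \<open>The product can be nonzero only at \<open>(k, k)\<close>, hence it is
      diagonal.\<close>
    fix s j l assume "s \<in> carrier (fin_matrices I)" "j \<in> I" "l \<in> I"
    then show "(matrix_unit I k j \<otimes>\<^bsub>fin_matrices I\<^esub> s) \<otimes>\<^bsub>fin_matrices I\<^esub> matrix_unit I l k
        \<in> identity_subring R (pair_groupoid I)"
      using k by (auto simp: identity_subring_iff entries closed)
  qed (use fin matrix_unit_closed in auto)
qed

end

theorem proposition47:
  fixes I :: "'i set" and B :: "('b, 'm) ring_scheme"
  assumes "ring B"
  shows "separable_extension (groupoid_ring B (pair_groupoid I))
           (identity_subring B (pair_groupoid I))"
  using ring.separable_fin_matrices[OF assms] .

end
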